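(* Let $X$ be an infinite-dimensional complex Hilbert space, let $A\in\mathcal{B}(X)$ be generalized Drazin invertible and let $B\in\mathcal{B}(X)$. Then the following statements are equivalent: (i) $A\leq^{\otimes}B$; (ii) the following matrix representations with respect to the orthogonal sum $X=R(A^d)\oplus N[(A^d)^*]$ hold: $$A=\begin{bmatrix}A_1&A_2\\0&A_3\end{bmatrix},\quad B=\begin{bmatrix}A_1&A_2+A_1^{-1}A_2(A_3-B_3)\\0&B_3\end{bmatrix},$$ where $A_1\in\mathcal{B}(R(A^d))$ is invertible and $A_3\in\mathcal{B}(N[(A^d)^*])$ is quasinilpotent.
   Context: $\mathcal{B}(X)$ is the set of bounded linear operators on $X$; $R(\cdot)$, $N(\cdot)$, $(\cdot)^*$ denote range, null space and adjoint; $P_L$ is the orthogonal projector onto a closed subspace $L$. $A\in\mathcal{B}(X)$ is generalized Drazin invertible if there is a (necessarily unique) $A^d\in\mathcal{B}(X)$ with $AA^d=A^dA$, $A^dAA^d=A^d$ and $A-A^2A^d$ quasinilpotent. The core-EP inverse $A^{\mathrm{cEP}}$ of such $A$ is the unique (it exists) operator $B\in\mathcal{B}(X)$ with $AB=P_{R(A^d)}$ and $R(B)\subseteq R(A^d)$. The weak group inverse of $A$ is $A^{\otimes}=(A^{\mathrm{cEP}})^2A$. Weak group relation: for $A$ generalized Drazin invertible and $B\in\mathcal{B}(X)$, $A\leq^{\otimes}B$ means $AA^{\otimes}=BA^{\otimes}$ and $A^{\otimes}A=A^{\otimes}B$. *)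

theory Defs
  imports "HOL-Analysis.Analysis"
begin

section \<open>Complex Hilbert spaces\<close>

text \<open>Completeness and the real normed structure come from \<open>banach\<close>; the inner product is
  linear in its first argument. The last axiom makes it positive definite.\<close>

class complex_hilbert = banach +
  fixes scaleC :: "complex \<Rightarrow> 'a \<Rightarrow> 'a" (infixr \<open>*\<^sub>C\<close> 75)
    and cinner :: "'a \<Rightarrow> 'a \<Rightarrow> complex"
  assumes scaleC_add_right: "c *\<^sub>C (x + y) = c *\<^sub>C x + c *\<^sub>C y"
    and scaleC_add_left: "(c + d) *\<^sub>C x = c *\<^sub>C x + d *\<^sub>C x"
    and scaleC_scaleC: "c *\<^sub>C d *\<^sub>C x = (c * d) *\<^sub>C x"
    and scaleC_of_real: "complex_of_real r *\<^sub>C x = r *\<^sub>R x"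
    and cinner_commute: "cinner x y = cnj (cinner y x)"
    and cinner_add_left: "cinner (x + y) z = cinner x z + cinner y z"
    and cinner_scaleC_left: "cinner (c *\<^sub>C x) y = c * cinner x y"
    and cinner_self: "cinner x x = complex_of_real ((norm x)\<^sup>2)"

global_interpretation complex_space: vector_space "scaleC :: complex \<Rightarrow> 'a \<Rightarrow> 'a::complex_hilbert"
  defines csubspace = complex_space.subspace
    and cspan = complex_space.span
proof
  show "1 *\<^sub>C x = x" for x :: 'a
    using scaleC_of_real[of 1 x] by simp
qed (simp_all add: scaleC_add_right scaleC_add_left scaleC_scaleC)

definition infinite_dimensional :: "'a::complex_hilbert itself \<Rightarrow> bool" where
  "infinite_dimensional _ \<longleftrightarrow> \<not> (\<exists>F :: 'a set. finite F \<and> cspan F = UNIV)"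


section \<open>Bounded operators\<close>

text \<open>\<open>bounded_ops L M\<close> is \<open>\<B>(L, M)\<close> for subspaces \<open>L\<close> and \<open>M\<close>. Its members are total
  functions of which only the values on \<open>L\<close> matter; \<open>\<B>(X)\<close> is \<open>bounded_ops UNIV UNIV\<close>.\<close>

definition bounded_ops ::
    "'a::complex_hilbert set \<Rightarrow> 'b::complex_hilbert set \<Rightarrow> ('a \<Rightarrow> 'b) set" where
  "bounded_ops L M = {T. T ` L \<subseteq> M \<and>
     (\<forall>x\<in>L. \<forall>y\<in>L. T (x + y) = T x + T y) \<and>
     (\<forall>c. \<forall>x\<in>L. T (c *\<^sub>C x) = c *\<^sub>C T x) \<and>
     (\<exists>K. \<forall>x\<in>L. norm (T x) \<le> K * norm x)}"

definition invertible_on :: "'a::complex_hilbert set \<Rightarrow> ('a \<Rightarrow> 'a) \<Rightarrow> bool" where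
  "invertible_on L T \<longleftrightarrow> T \<in> bounded_ops L L \<and>
     (\<exists>S\<in>bounded_ops L L. \<forall>x\<in>L. S (T x) = x \<and> T (S x) = x)"

definition spectrum_on :: "'a::complex_hilbert set \<Rightarrow> ('a \<Rightarrow> 'a) \<Rightarrow> complex set" where
  "spectrum_on L T = {z. \<not> invertible_on L (\<lambda>x. T x - z *\<^sub>C x)}"

text \<open>The spectrum is nonempty unless \<open>L = {0}\<close>. Inclusion instead of equality with \<open>{0}\<close>
  makes the operator on the zero space quasinilpotent; that space occurs as \<open>N((A\<^sup>d)\<^sup>*)\<close>
  when \<open>A\<close> is invertible.\<close>

definition quasinilpotent_on :: "'a::complex_hilbert set \<Rightarrow> ('a \<Rightarrow> 'a) \<Rightarrow> bool" where
  "quasinilpotent_on L T \<longleftrightarrow> T \<in> bounded_ops L L \<and> spectrum_on L T \<subseteq> {0}"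

definition null_space :: "('a \<Rightarrow> 'b::zero) \<Rightarrow> 'a set" where
  "null_space T = {x. T x = 0}"

definition adj :: "('a::complex_hilbert \<Rightarrow> 'a) \<Rightarrow> 'a \<Rightarrow> 'a" where
  "adj T = (SOME S. S \<in> bounded_ops UNIV UNIV \<and> (\<forall>x y. cinner (T x) y = cinner x (S y)))"

definition orth_proj :: "'a::complex_hilbert set \<Rightarrow> 'a \<Rightarrow> 'a" where
  "orth_proj L x = (THE p. p \<in> L \<and> (\<forall>y\<in>L. cinner (x - p) y = 0))"


section \<open>Generalized inverses and the weak group relation\<close>

text \<open>The operators picked by \<open>SOME\<close> below are unique; for operators that are not generalized
  Drazin invertible they are unspecified.\<close>

definition is_gdrazin_inverse :: "('a::complex_hilbert \<Rightarrow> 'a) \<Rightarrow> ('a \<Rightarrow> 'a) \<Rightarrow> bool" where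
  "is_gdrazin_inverse A D \<longleftrightarrow> D \<in> bounded_ops UNIV UNIV \<and>
     A \<circ> D = D \<circ> A \<and> D \<circ> A \<circ> D = D \<and>
     quasinilpotent_on UNIV (\<lambda>x. A x - A (A (D x)))"

definition gdrazin_invertible :: "('a::complex_hilbert \<Rightarrow> 'a) \<Rightarrow> bool" where
  "gdrazin_invertible A \<longleftrightarrow> A \<in> bounded_ops UNIV UNIV \<and> (\<exists>D. is_gdrazin_inverse A D)"

definition gdrazin :: "('a::complex_hilbert \<Rightarrow> 'a) \<Rightarrow> 'a \<Rightarrow> 'a" where
  "gdrazin A = (SOME D. is_gdrazin_inverse A D)"

definition core_EP :: "('a::complex_hilbert \<Rightarrow> 'a) \<Rightarrow> 'a \<Rightarrow> 'a" where
  "core_EP A = (SOME B. B \<in> bounded_ops UNIV UNIV \<and>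
     A \<circ> B = orth_proj (range (gdrazin A)) \<and> range B \<subseteq> range (gdrazin A))"

definition weak_group_inverse :: "('a::complex_hilbert \<Rightarrow> 'a) \<Rightarrow> 'a \<Rightarrow> 'a" where
  "weak_group_inverse A = core_EP A \<circ> core_EP A \<circ> A"

definition weak_group_le :: "('a::complex_hilbert \<Rightarrow> 'a) \<Rightarrow> ('a \<Rightarrow> 'a) \<Rightarrow> bool"
    (infix \<open>\<le>\<^sub>w\<^sub>g\<close> 50) where
  "A \<le>\<^sub>w\<^sub>g B \<longleftrightarrow>
     A \<circ> weak_group_inverse A = B \<circ> weak_group_inverse A \<and>
     weak_group_inverse A \<circ> A = weak_group_inverse A \<circ> B"


section \<open>Block operator matrices\<close>

definition orthogonal_sum :: "'a::complex_hilbert set \<Rightarrow> 'a set \<Rightarrow> bool" where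
  "orthogonal_sum L M \<longleftrightarrow> csubspace L \<and> closed L \<and> csubspace M \<and> closed M \<and>
     (\<forall>x\<in>L. \<forall>y\<in>M. cinner x y = 0) \<and> (\<forall>z. \<exists>x\<in>L. \<exists>y\<in>M. z = x + y)"

text \<open>\<open>block_rep L M T T11 T12 T21 T22\<close>: with respect to the orthogonal sum of \<open>L\<close> and \<open>M\<close>,
  the operator \<open>T\<close> has first row \<open>T11\<close>, \<open>T12\<close> and second row \<open>T21\<close>, \<open>T22\<close>.\<close>

definition block_rep :: "'a::complex_hilbert set \<Rightarrow> 'a set \<Rightarrow> ('a \<Rightarrow> 'a) \<Rightarrow>
    ('a \<Rightarrow> 'a) \<Rightarrow> ('a \<Rightarrow> 'a) \<Rightarrow> ('a \<Rightarrow> 'a) \<Rightarrow> ('a \<Rightarrow> 'a) \<Rightarrow> bool" where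
  "block_rep L M T T11 T12 T21 T22 \<longleftrightarrow> orthogonal_sum L M \<and>
     T11 \<in> bounded_ops L L \<and> T12 \<in> bounded_ops M L \<and>
     T21 \<in> bounded_ops L M \<and> T22 \<in> bounded_ops M M \<and>
     (\<forall>x\<in>L. \<forall>y\<in>M. T (x + y) = (T11 x + T12 y) + (T21 x + T22 y))"

end

theory Submission
  imports Defs
begin

text \<open>Write \<open>D\<close> for the generalized Drazin inverse and \<open>P\<close> for the orthogonal projector onto
  \<open>L = R(D)\<close>. On \<open>L\<close> the operators \<open>A\<close> and \<open>D\<close> are inverse to each other, so the core-EP inverse
  is \<open>DP\<close> and the weak group inverse is \<open>W = D\<^sup>2PA\<close>. Its range is \<open>L\<close>, hence \<open>AW = BW\<close>
  says that \<open>A\<close> and \<open>B\<close> agree on \<open>L\<close>; its null space is that of \<open>PA\<close>, hence \<open>WA = WB\<close>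
  says that \<open>PA(A - B) = 0\<close>, which on the orthogonal complement is the formula for the
  upper right corner of \<open>B\<close>. The resolvent of \<open>A - A\<^sup>2D\<close> leaves \<open>L\<close> invariant, and its
  compression to the complement inverts \<open>A\<^sub>3 - z\<close>.\<close>

section \<open>Complex inner product\<close>

lemma cinner_add_right: "cinner x (y + z) = cinner x y + cinner x z"
  by (metis cinner_add_left cinner_commute complex_cnj_add)

lemma cinner_scaleC_right: "cinner x (c *\<^sub>C y) = cnj c * cinner x y"
  by (metis cinner_commute cinner_scaleC_left complex_cnj_mult)

lemma cinner_zero_left [simp]: "cinner 0 y = 0"
  using cinner_add_left[of 0 0 y] by simp

lemma cinner_zero_right [simp]: "cinner x 0 = 0"
  using cinner_add_right[of x 0 0] by simp

lemma cinner_minus_left: "cinner (- x) y = - cinner x y"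
  using cinner_add_left[of x "- x" y] by (simp add: eq_neg_iff_add_eq_0 add.commute)

lemma cinner_diff_left: "cinner (x - y) z = cinner x z - cinner y z"
  using cinner_add_left[of x "- y" z] by (simp add: cinner_minus_left)

lemma cinner_diff_right: "cinner x (y - z) = cinner x y - cinner x z"
  by (metis cinner_commute cinner_diff_left complex_cnj_diff)

lemma cinner_eq_zero_commute: "cinner x y = 0 \<longleftrightarrow> cinner y x = 0"
  by (metis cinner_commute complex_cnj_zero)

lemma cinner_self_eq_zero [simp]: "cinner x x = 0 \<longleftrightarrow> x = 0"
  by (simp add: cinner_self)

lemma norm_square_cinner: "(norm x)\<^sup>2 = Re (cinner x x)"
  by (simp add: cinner_self)

text \<open>The normed structure of the class knows real scalars only; homogeneity for complex ones
  is read off from \<open>cinner_self\<close>.\<close>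

lemma norm_scaleC: "norm (c *\<^sub>C x) = cmod c * norm (x :: 'a::complex_hilbert)"
proof -
  have "complex_of_real ((norm (c *\<^sub>C x))\<^sup>2) = cinner (c *\<^sub>C x) (c *\<^sub>C x)"
    by (simp only: cinner_self)
  also have "\<dots> = (c * cnj c) * cinner x x"
    by (simp add: cinner_scaleC_left cinner_scaleC_right)
  also have "\<dots> = complex_of_real ((cmod c * norm x)\<^sup>2)"
    by (simp only: complex_norm_square[symmetric] cinner_self power_mult_distrib of_real_mult)
  finally have "(norm (c *\<^sub>C x))\<^sup>2 = (cmod c * norm x)\<^sup>2"
    by (simp only: of_real_eq_iff)
  then show ?thesis
    by (simp add: power2_eq_iff_nonneg)
qed

text \<open>For \<open>t = 1 / (norm y)^2\<close> the vector subtracted from \<open>x\<close> is its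
  projection onto the line of \<open>y\<close>. This value of \<open>t\<close> serves both
  Cauchy-Schwarz and the variational argument for orthogonal projections.\<close>

lemma norm_diff_scaleC_square:
  fixes x y :: "'a::complex_hilbert"
  shows "(norm (x - (complex_of_real t * cinner x y) *\<^sub>C y))\<^sup>2 =
    (norm x)\<^sup>2 - 2 * t * (cmod (cinner x y))\<^sup>2 + t\<^sup>2 * (cmod (cinner x y))\<^sup>2 * (norm y)\<^sup>2"
proof -
  let ?z = "x - (complex_of_real t * cinner x y) *\<^sub>C y"
  have "complex_of_real ((norm ?z)\<^sup>2) = cinner ?z ?z"
    by (simp only: cinner_self)
  also have "\<dots> = cinner x x - 2 * of_real t * (cinner x y * cnj (cinner x y))
       + of_real (t\<^sup>2) * (cinner x y * cnj (cinner x y)) * cinner y y"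
    by (simp add: cinner_diff_left cinner_diff_right cinner_scaleC_left cinner_scaleC_right
        cinner_commute[of y x] algebra_simps power2_eq_square)
  also have "\<dots> = complex_of_real ((norm x)\<^sup>2 - 2 * t * (cmod (cinner x y))\<^sup>2
       + t\<^sup>2 * (cmod (cinner x y))\<^sup>2 * (norm y)\<^sup>2)"
    by (simp only: complex_norm_square[symmetric] cinner_self of_real_mult of_real_add of_real_diff
        of_real_numeral)
  finally show ?thesis
    by (simp only: of_real_eq_iff)
qed

lemma cauchy_schwarz: "cmod (cinner x y) \<le> norm x * norm y"
proof (cases "y = 0")
  case False
  have "0 \<le> (norm x)\<^sup>2 - 2 * (1 / (norm y)\<^sup>2) * (cmod (cinner x y))\<^sup>2
      + (1 / (norm y)\<^sup>2)\<^sup>2 * (cmod (cinner x y))\<^sup>2 * (norm y)\<^sup>2"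
    unfolding norm_diff_scaleC_square[symmetric] by simp
  also have "\<dots> = (norm x)\<^sup>2 - (cmod (cinner x y))\<^sup>2 / (norm y)\<^sup>2"
    using False by (simp add: field_simps power2_eq_square)
  finally have "(cmod (cinner x y))\<^sup>2 \<le> (norm x * norm y)\<^sup>2"
    using False by (simp add: field_simps)
  then show ?thesis
    by (rule power2_le_imp_le) simp
qed simp

lemma bounded_linear_cinner_left: "bounded_linear (\<lambda>x. cinner x y)"
proof (rule bounded_linear_intro)
  show "cinner (r *\<^sub>R x) y = r *\<^sub>R cinner x y" for r x
    by (simp add: scaleC_of_real[symmetric] cinner_scaleC_left scaleR_conv_of_real)
qed (auto simp: cinner_add_left intro: cauchy_schwarz)

lemma parallelogram_law:
  fixes x y :: "'a::complex_hilbert"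
  shows "(norm (x + y))\<^sup>2 + (norm (x - y))\<^sup>2 = 2 * (norm x)\<^sup>2 + 2 * (norm y)\<^sup>2"
  by (simp add: norm_square_cinner cinner_add_left cinner_add_right cinner_diff_left cinner_diff_right)

lemma pythagoras:
  assumes "cinner x y = 0"
  shows "(norm (x + y))\<^sup>2 = (norm x)\<^sup>2 + (norm y)\<^sup>2"
  using assms cinner_eq_zero_commute[of x y]
  by (simp add: norm_square_cinner cinner_add_left cinner_add_right)

lemma csubspace_scaleR: "csubspace L \<Longrightarrow> x \<in> L \<Longrightarrow> r *\<^sub>R x \<in> L"
  by (metis complex_space.subspace_scale scaleC_of_real)


section \<open>Orthogonal projection and Riesz representation\<close>

text \<open>A minimizing sequence is Cauchy by the parallelogram law, because midpoints stay in
  \<open>L\<close>; completeness supplies a limit and closedness keeps it in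
  \<open>L\<close>.\<close>

lemma minimizer_in_closed_csubspace:
  fixes L :: "'a::complex_hilbert set"
  assumes L: "csubspace L" "closed L"
  obtains p where "p \<in> L" "\<And>y. y \<in> L \<Longrightarrow> norm (x - p) \<le> norm (x - y)"
proof -
  define d where "d = infdist x L"
  have ne: "L \<noteq> {}"
    using complex_space.subspace_0[OF L(1)] by auto
  have d_le: "d \<le> norm (x - y)" if "y \<in> L" for y
    unfolding d_def using infdist_le[OF that, of x] by (simp add: dist_norm)
  have d0: "0 \<le> d"
    by (simp add: d_def infdist_nonneg)
  \<comment> \<open>The slack is put on the squared distance, so that the parallelogram law turns it
    directly into a bound on \<open>(norm (p m - p n))^2\<close>.\<close>
  have "\<exists>y\<in>L. (norm (x - y))\<^sup>2 < d\<^sup>2 + 1 / real (Suc n)" for n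
  proof -
    have "d < sqrt (d\<^sup>2 + 1 / real (Suc n))"
      by (rule real_less_rsqrt) simp
    then have "\<exists>y\<in>L. dist x y < sqrt (d\<^sup>2 + 1 / real (Suc n))"
      unfolding d_def infdist_notempty[OF ne] by (subst (asm) cINF_less_iff) (auto simp: ne)
    then obtain y where "y \<in> L" "norm (x - y) < sqrt (d\<^sup>2 + 1 / real (Suc n))"
      by (auto simp: dist_norm)
    then have "(norm (x - y))\<^sup>2 < (sqrt (d\<^sup>2 + 1 / real (Suc n)))\<^sup>2"
      by (intro power_strict_mono) auto
    with \<open>y \<in> L\<close> show ?thesis
      by (intro bexI[of _ y]) auto
  qed
  then obtain p where pL: "\<And>n. p n \<in> L" and p: "\<And>n. (norm (x - p n))\<^sup>2 < d\<^sup>2 + 1 / real (Suc n)"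
    by metis
  have dist: "(norm (p m - p n))\<^sup>2 \<le> 2 / real (Suc m) + 2 / real (Suc n)" for m n
  proof -
    have mid: "(1/2) *\<^sub>R (p m + p n) \<in> L"
      by (intro csubspace_scaleR complex_space.subspace_add L(1) pL)
    have "(x - p m) + (x - p n) = 2 *\<^sub>R (x - (1/2) *\<^sub>R (p m + p n))"
      by (simp add: algebra_simps scaleR_2)
    then have "(norm ((x - p m) + (x - p n)))\<^sup>2 = 4 * (norm (x - (1/2) *\<^sub>R (p m + p n)))\<^sup>2"
      by (simp add: power_mult_distrib)
    moreover have "d\<^sup>2 \<le> (norm (x - (1/2) *\<^sub>R (p m + p n)))\<^sup>2"
      using d_le[OF mid] d0 by (rule power_mono)
    moreover have "norm ((x - p m) - (x - p n)) = norm (p m - p n)"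
      by (simp add: norm_minus_commute)
    ultimately show ?thesis
      using parallelogram_law[of "x - p m" "x - p n"] p[of m] p[of n] by simp
  qed
  have "Cauchy p"
    unfolding Cauchy_altdef2
  proof (intro allI impI)
    fix e :: real assume "0 < e"
    \<comment> \<open>With this \<open>N\<close>, the bound \<open>2 / (n+1) + 2 / (N+1)\<close> is
      at most \<open>4 / (N+1)\<close>, hence below \<open>e^2\<close>, for all \<open>n\<close>
      from \<open>N\<close> on.\<close>
    then obtain N where N: "inverse (real (Suc N)) < e\<^sup>2 / 4"
      using reals_Archimedean[of "e\<^sup>2 / 4"] by auto
    have "dist (p n) (p N) < e" if "n \<ge> N" for n
    proof -
      have "2 / real (Suc n) \<le> 2 / real (Suc N)"
        using that by (intro divide_left_mono) auto
      moreover have "2 / real (Suc N) < e\<^sup>2 / 2"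
        unfolding divide_inverse[of 2 "real (Suc N)"] using N by linarith
      ultimately have "(norm (p n - p N))\<^sup>2 < e\<^sup>2"
        using dist[of n N] by linarith
      then show ?thesis
        using \<open>0 < e\<close> by (simp add: dist_norm power2_less_imp_less)
    qed
    then show "\<exists>N. \<forall>n\<ge>N. dist (p n) (p N) < e"
      by blast
  qed
  then obtain q where q: "p \<longlonglongrightarrow> q"
    by (auto simp: Cauchy_convergent_iff convergent_def)
  have "(\<lambda>n. (norm (x - p n))\<^sup>2) \<longlonglongrightarrow> (norm (x - q))\<^sup>2"
    by (intro tendsto_intros q)
  moreover have "(\<lambda>n. d\<^sup>2 + 1 / real (Suc n)) \<longlonglongrightarrow> d\<^sup>2 + 0"
    by (intro tendsto_intros LIMSEQ_Suc[OF lim_1_over_n])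
  ultimately have "(norm (x - q))\<^sup>2 \<le> d\<^sup>2"
    using p by (intro LIMSEQ_le[where Y = "\<lambda>n. d\<^sup>2 + 1 / real (Suc n)"]) (auto intro: less_imp_le)
  then have "norm (x - q) \<le> d"
    using d0 by (rule power2_le_imp_le)
  moreover have "q \<in> L"
    using L(2) pL q by (rule closed_sequentially)
  ultimately show thesis
    using d_le by (intro that[of q]) (auto intro: order_trans)
qed

text \<open>A nearest point \<open>p\<close> works: if \<open>x - p\<close> were not orthogonal to
  some \<open>y\<close> in \<open>L\<close>, moving \<open>p\<close> along \<open>y\<close> would
  bring it closer to \<open>x\<close>.\<close>

lemma orth_proj_exists:
  fixes L :: "'a::complex_hilbert set"
  assumes L: "csubspace L" "closed L"
  shows "\<exists>p\<in>L. \<forall>y\<in>L. cinner (x - p) y = 0"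
proof -
  obtain p where pL: "p \<in> L" and min: "\<And>y. y \<in> L \<Longrightarrow> norm (x - p) \<le> norm (x - y)"
    using minimizer_in_closed_csubspace[OF L] by blast
  have "cinner (x - p) y = 0" if y: "y \<in> L" for y
  proof (rule ccontr)
    assume nz: "cinner (x - p) y \<noteq> 0"
    let ?w = "cinner (x - p) y"
    have y0: "norm y \<noteq> 0"
      using nz by auto
    have "norm (x - p) \<le> norm (x - (p + (complex_of_real (1 / (norm y)\<^sup>2) * ?w) *\<^sub>C y))"
      by (intro min complex_space.subspace_add complex_space.subspace_scale L(1) pL y)
    then have "(norm (x - p))\<^sup>2 \<le> (norm (x - p - (complex_of_real (1 / (norm y)\<^sup>2) * ?w) *\<^sub>C y))\<^sup>2"
      by (simp add: diff_diff_eq power_mono)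
    also have "\<dots> = (norm (x - p))\<^sup>2 - (cmod ?w)\<^sup>2 / (norm y)\<^sup>2"
      unfolding norm_diff_scaleC_square using y0 by (simp add: field_simps power2_eq_square)
    finally show False
      using nz y0 by (simp add: divide_le_0_iff)
  qed
  with pL show ?thesis
    by blast
qed

text \<open>Two candidates differ by a vector of \<open>L\<close> that is orthogonal to itself.
  Besides making the description in \<open>orth_proj\<close> definite, this is the way projections
  are computed below.\<close>

lemma orth_proj_eqI:
  assumes L: "csubspace L" and p: "p \<in> L" "\<And>y. y \<in> L \<Longrightarrow> cinner (x - p) y = 0"
  shows "orth_proj L x = p"
  unfolding orth_proj_def
proof (rule the_equality)
  fix q assume q: "q \<in> L \<and> (\<forall>y\<in>L. cinner (x - q) y = 0)"
  then have "p - q \<in> L"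
    using complex_space.subspace_diff[OF L] p by blast
  then have "cinner ((x - q) - (x - p)) (p - q) = 0"
    using q p(2) by (simp only: cinner_diff_left) simp
  then show "q = p"
    by simp
qed (use p in blast)

lemma orth_proj:
  assumes "csubspace L" "closed L"
  shows orth_proj_in: "orth_proj L x \<in> L"
    and orth_proj_orthogonal: "y \<in> L \<Longrightarrow> cinner (x - orth_proj L x) y = 0"
  using orth_proj_exists[OF assms, of x] orth_proj_eqI[OF assms(1)] by metis+

lemma orth_proj_id: "csubspace L \<Longrightarrow> x \<in> L \<Longrightarrow> orth_proj L x = x"
  by (rule orth_proj_eqI) auto

lemma orth_proj_bounded_ops:
  assumes L: "csubspace L" "closed L"
  shows "orth_proj L \<in> bounded_ops UNIV L"
proof -
  note P = orth_proj_in[OF L] orth_proj_orthogonal[OF L]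
  have "orth_proj L (x + y) = orth_proj L x + orth_proj L y" for x y
  proof (rule orth_proj_eqI[OF L(1)])
    show "orth_proj L x + orth_proj L y \<in> L"
      by (intro complex_space.subspace_add L(1) P)
    show "cinner (x + y - (orth_proj L x + orth_proj L y)) z = 0" if "z \<in> L" for z
      using P(2)[OF that, of x] P(2)[OF that, of y]
      by (simp add: cinner_diff_left cinner_add_left)
  qed
  moreover have "orth_proj L (c *\<^sub>C x) = c *\<^sub>C orth_proj L x" for c x
  proof (rule orth_proj_eqI[OF L(1)])
    show "c *\<^sub>C orth_proj L x \<in> L"
      by (intro complex_space.subspace_scale L(1) P)
    show "cinner (c *\<^sub>C x - c *\<^sub>C orth_proj L x) z = 0" if "z \<in> L" for z
      using P(2)[OF that, of x] by (simp add: cinner_diff_left cinner_scaleC_left)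
  qed
  moreover have "norm (orth_proj L x) \<le> 1 * norm x" for x
  proof -
    have "(norm ((x - orth_proj L x) + orth_proj L x))\<^sup>2 =
        (norm (x - orth_proj L x))\<^sup>2 + (norm (orth_proj L x))\<^sup>2"
      using P by (intro pythagoras) blast
    then have "(norm (orth_proj L x))\<^sup>2 \<le> (norm x)\<^sup>2"
      by simp
    then show ?thesis
      by (auto intro: power2_le_imp_le)
  qed
  ultimately show ?thesis
    unfolding bounded_ops_def using P(1) by blast
qed

text \<open>A nonzero functional is determined by its kernel \<open>K\<close> and its value at a
  single vector orthogonal to \<open>K\<close>.\<close>

lemma riesz_representation:
  fixes f :: "'a::complex_hilbert \<Rightarrow> complex"
  assumes f: "bounded_linear f" and hom: "\<And>c x. f (c *\<^sub>C x) = c * f x"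
  shows "\<exists>u. \<forall>x. f x = cinner x u"
proof (cases "\<forall>x. f x = 0")
  case True
  then show ?thesis
    by (intro exI[of _ 0]) simp
next
  case False
  then obtain v where v: "f v \<noteq> 0"
    by blast
  interpret bounded_linear f by (rule f)
  define K where "K = {x. f x = 0}"
  have "csubspace K"
    unfolding K_def complex_space.subspace_def by (auto simp: add hom zero)
  moreover have "closed K"
    unfolding K_def by (intro closed_Collect_eq continuous_on continuous_on_const) (rule continuous_on_id)
  ultimately obtain p where p: "p \<in> K" "\<And>y. y \<in> K \<Longrightarrow> cinner (v - p) y = 0"
    using orth_proj_exists[of K v] by blast
  define e where "e = v - p"
  have fe: "f e \<noteq> 0"
    using p(1) v by (simp add: e_def K_def diff)
  then have e0: "e \<noteq> 0"
    using zero by auto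
  \<comment> \<open>The combination of \<open>x\<close> and \<open>e\<close> formed next lies in
    \<open>K\<close>, so it is orthogonal to \<open>e\<close>; solving that equation for
    \<open>f x\<close> yields this vector.\<close>
  have "f x = cinner x (cnj (f e / cinner e e) *\<^sub>C e)" for x
  proof -
    have "f e *\<^sub>C x - f x *\<^sub>C e \<in> K"
      by (simp add: K_def diff hom)
    then have "cinner (f e *\<^sub>C x - f x *\<^sub>C e) e = 0"
      using p(2) cinner_eq_zero_commute unfolding e_def by blast
    then have "f e * cinner x e = f x * cinner e e"
      by (simp add: cinner_diff_left cinner_scaleC_left)
    with e0 show ?thesis
      by (simp add: cinner_scaleC_right field_simps)
  qed
  then show ?thesis
    by blast
qed


section \<open>Bounded operators and adjoints\<close>

lemma bounded_opsD:
  assumes "T \<in> bounded_ops L M"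
  shows bounded_ops_in: "x \<in> L \<Longrightarrow> T x \<in> M"
    and bounded_ops_add: "x \<in> L \<Longrightarrow> y \<in> L \<Longrightarrow> T (x + y) = T x + T y"
    and bounded_ops_scaleC: "x \<in> L \<Longrightarrow> T (c *\<^sub>C x) = c *\<^sub>C T x"
  using assms unfolding bounded_ops_def by auto

lemma bounded_ops_bound:
  assumes "T \<in> bounded_ops L M"
  obtains K where "0 \<le> K" "\<And>x. x \<in> L \<Longrightarrow> norm (T x) \<le> K * norm x"
proof -
  obtain K where K: "\<And>x. x \<in> L \<Longrightarrow> norm (T x) \<le> K * norm x"
    using assms unfolding bounded_ops_def by blast
  have "norm (T x) \<le> \<bar>K\<bar> * norm x" if "x \<in> L" for x
    using K[OF that] mult_right_mono[OF abs_ge_self[of K] norm_ge_zero[of x]] by linarith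
  then show thesis
    using that[of "\<bar>K\<bar>"] by simp
qed

lemma bounded_ops_zero: "T \<in> bounded_ops L M \<Longrightarrow> 0 \<in> L \<Longrightarrow> T 0 = 0"
  using bounded_ops_scaleC[of T L M 0 0] by simp

lemma bounded_ops_diff:
  assumes "T \<in> bounded_ops L M" "csubspace L" "x \<in> L" "y \<in> L"
  shows "T (x - y) = T x - T y"
  using bounded_ops_add[OF assms(1), of "x - y" y] complex_space.subspace_diff[OF assms(2-4)] assms(4)
  by (simp add: algebra_simps)

lemma bounded_ops_mono: "T \<in> bounded_ops L M \<Longrightarrow> L' \<subseteq> L \<Longrightarrow> T ` L' \<subseteq> M' \<Longrightarrow> T \<in> bounded_ops L' M'"
  unfolding bounded_ops_def by blast

lemma bounded_ops_compose:
  assumes S: "S \<in> bounded_ops M N" and T: "T \<in> bounded_ops L M"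
  shows "(\<lambda>x. S (T x)) \<in> bounded_ops L N"
proof -
  obtain J where J: "0 \<le> J" "\<And>y. y \<in> M \<Longrightarrow> norm (S y) \<le> J * norm y"
    using bounded_ops_bound[OF S] by blast
  obtain K where K: "\<And>x. x \<in> L \<Longrightarrow> norm (T x) \<le> K * norm x"
    using bounded_ops_bound[OF T] by blast
  have "norm (S (T x)) \<le> J * K * norm x" if "x \<in> L" for x
    using J(2)[OF bounded_ops_in[OF T that]] mult_left_mono[OF K[OF that] J(1)] by simp
  then show ?thesis
    using bounded_opsD[OF S] bounded_opsD[OF T] unfolding bounded_ops_def by auto
qed

lemma bounded_ops_minus:
  assumes S: "S \<in> bounded_ops L M" and T: "T \<in> bounded_ops L M" and M: "csubspace M"
  shows "(\<lambda>x. S x - T x) \<in> bounded_ops L M"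
proof -
  obtain J where J: "\<And>x. x \<in> L \<Longrightarrow> norm (S x) \<le> J * norm x"
    using bounded_ops_bound[OF S] by blast
  obtain K where K: "\<And>x. x \<in> L \<Longrightarrow> norm (T x) \<le> K * norm x"
    using bounded_ops_bound[OF T] by blast
  have "norm (S x - T x) \<le> (J + K) * norm x" if "x \<in> L" for x
    using norm_triangle_ineq4[of "S x" "T x"] J[OF that] K[OF that] by (simp add: algebra_simps)
  moreover have "S x - T x \<in> M" if "x \<in> L" for x
    using bounded_ops_in[OF S that] bounded_ops_in[OF T that] by (intro complex_space.subspace_diff M)
  moreover have "S (x + y) - T (x + y) = (S x - T x) + (S y - T y)" if "x \<in> L" "y \<in> L" for x y
    by (simp add: bounded_ops_add[OF S that] bounded_ops_add[OF T that])
  moreover have "S (c *\<^sub>C x) - T (c *\<^sub>C x) = c *\<^sub>C (S x - T x)" if "x \<in> L" for c x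
    by (simp add: bounded_ops_scaleC[OF S that] bounded_ops_scaleC[OF T that]
        complex_space.scale_right_diff_distrib)
  ultimately show ?thesis
    unfolding bounded_ops_def by blast
qed

lemma bounded_ops_const_zero: "0 \<in> M \<Longrightarrow> (\<lambda>x. 0) \<in> bounded_ops L M"
  unfolding bounded_ops_def by (auto intro: exI[of _ 0])

lemma bounded_ops_mult_left: "csubspace L \<Longrightarrow> (\<lambda>x. z *\<^sub>C x) \<in> bounded_ops L L"
  unfolding bounded_ops_def
  by (auto simp: complex_space.subspace_scale scaleC_add_right scaleC_scaleC mult.commute norm_scaleC
      intro: exI[of _ "cmod z"])

lemma bounded_ops_bounded_linear:
  assumes T: "T \<in> bounded_ops UNIV M"
  shows "bounded_linear T"
proof -
  obtain K where "\<And>x. x \<in> UNIV \<Longrightarrow> norm (T x) \<le> K * norm x"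
    using bounded_ops_bound[OF T] by blast
  then show ?thesis
    using bounded_opsD[OF T]
    by (intro bounded_linear_intro[of _ K]) (auto simp: scaleC_of_real[symmetric] mult.commute)
qed

text \<open>Riesz representation of the functionals \<open>x\<close> to
  \<open>cinner (T x) y\<close> produces an adjoint, so the choice in \<open>adj\<close> has a
  witness.\<close>

lemma cinner_adj:
  fixes T :: "'a::complex_hilbert \<Rightarrow> 'a"
  assumes T: "T \<in> bounded_ops UNIV UNIV"
  shows "cinner (T x) y = cinner x (adj T y)"
proof -
  have "\<exists>u. \<forall>x. cinner (T x) y = cinner x u" for y
    using bounded_linear_compose[OF bounded_linear_cinner_left bounded_ops_bounded_linear[OF T]]
    by (intro riesz_representation)
      (auto simp: bounded_ops_scaleC[OF T] cinner_scaleC_left)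
  then obtain S where S: "\<And>x y. cinner (T x) y = cinner x (S y)"
    by metis
  have eqI: "u = v" if "\<And>x. cinner x u = cinner x v" for u v :: 'a
  proof -
    have "cinner (u - v) (u - v) = 0"
      using that[of "u - v"] by (simp only: cinner_diff_right) simp
    then show ?thesis
      by simp
  qed
  obtain K where K: "0 \<le> K" "\<And>x. x \<in> UNIV \<Longrightarrow> norm (T x) \<le> K * norm x"
    using bounded_ops_bound[OF T] by blast
  have "norm (S y) \<le> K * norm y" for y
  proof (cases "S y = 0")
    case False
    \<comment> \<open>Testing the adjoint relation at \<open>x = S y\<close> leaves a factor
      \<open>norm (S y)\<close> on both sides, which cancels to give the bound
      \<open>K\<close>.\<close>
    have "(norm (S y))\<^sup>2 = cmod (cinner (T (S y)) y)"
      by (simp add: S cinner_self norm_power)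
    also have "\<dots> \<le> norm (T (S y)) * norm y"
      by (rule cauchy_schwarz)
    also have "\<dots> \<le> K * norm (S y) * norm y"
      by (intro mult_right_mono K) simp_all
    finally have "norm (S y) * norm (S y) \<le> norm (S y) * (K * norm y)"
      by (simp only: power2_eq_square ac_simps)
    then show ?thesis
      by (rule mult_left_le_imp_le) (use False in simp)
  qed (simp add: K)
  moreover have "S (y + z) = S y + S z" "S (c *\<^sub>C y) = c *\<^sub>C S y" for c y z
    by (rule eqI, simp add: S[symmetric] cinner_add_right cinner_scaleC_right)+
  ultimately have "S \<in> bounded_ops UNIV UNIV"
    unfolding bounded_ops_def by auto
  with S have "adj T \<in> bounded_ops UNIV UNIV \<and> (\<forall>x y. cinner (T x) y = cinner x (adj T y))"
    unfolding adj_def by (intro someI_ex[of "\<lambda>S. S \<in> bounded_ops UNIV UNIV \<and> _ S"]) blast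
  then show ?thesis
    by blast
qed

text \<open>This identifies the second summand of the decomposition as the orthogonal complement of
  the range. For the converse inclusion the adjoint relation is tested at
  \<open>x = adj T y\<close>.\<close>

lemma mem_null_space_adj_iff:
  assumes "T \<in> bounded_ops UNIV UNIV"
  shows "y \<in> null_space (adj T) \<longleftrightarrow> (\<forall>x\<in>range T. cinner x y = 0)"
  unfolding null_space_def using cinner_adj[OF assms]
  by (auto simp: image_iff) (metis cinner_self_eq_zero)

lemma orthogonal_sum_complement:
  assumes L: "csubspace L" "closed L" and M: "\<And>y. y \<in> M \<longleftrightarrow> (\<forall>x\<in>L. cinner x y = 0)"
  shows "orthogonal_sum L M"
proof -
  note P = orth_proj_in[OF L] orth_proj_orthogonal[OF L]
  have "csubspace M"
    unfolding complex_space.subspace_def by (auto simp: M cinner_add_right cinner_scaleC_right)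
  \<comment> \<open>As the kernel of a continuous map, \<open>M\<close> is closed.\<close>
  moreover have "M = {y. orth_proj L y = 0}"
  proof (intro set_eqI iffI CollectI)
    show "orth_proj L y = 0" if "y \<in> M" for y
      using that M complex_space.subspace_0[OF L(1)]
      by (intro orth_proj_eqI[OF L(1)]) (auto simp: cinner_eq_zero_commute)
    show "y \<in> M" if "y \<in> {y. orth_proj L y = 0}" for y
      unfolding M using P(2)[of _ y] that by (auto simp: cinner_eq_zero_commute)
  qed
  then have "closed M"
    using bounded_linear.continuous_on[OF bounded_ops_bounded_linear[OF orth_proj_bounded_ops[OF L]]]
    by (auto intro!: closed_Collect_eq continuous_on_const continuous_on_id)
  moreover have "\<exists>x\<in>L. \<exists>y\<in>M. z = x + y" for z
    using P by (intro bexI[of _ "orth_proj L z"] bexI[of _ "z - orth_proj L z"])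
      (auto simp: M cinner_eq_zero_commute)
  ultimately show ?thesis
    unfolding orthogonal_sum_def using L M by blast
qed


section \<open>The generalized Drazin inverse\<close>

text \<open>Everything follows from \<open>DAD = D\<close> and \<open>AD = DA\<close>: the product
  \<open>DA\<close> is a bounded idempotent with range \<open>R(D)\<close>.\<close>

lemma gdrazin_inverse_range:
  assumes A: "A \<in> bounded_ops UNIV UNIV" and D: "is_gdrazin_inverse A D"
  shows csubspace_range_gdrazin_inverse: "csubspace (range D)"
    and closed_range_gdrazin_inverse: "closed (range D)"
    and gdrazin_inverse_left: "x \<in> range D \<Longrightarrow> D (A x) = x"
    and gdrazin_inverse_right: "x \<in> range D \<Longrightarrow> A (D x) = x"
    and gdrazin_inverse_invariant: "x \<in> range D \<Longrightarrow> A x \<in> range D"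
proof -
  have Dop: "D \<in> bounded_ops UNIV UNIV" and comm: "\<And>x. A (D x) = D (A x)"
    and DAD: "\<And>x. D (A (D x)) = D x"
    using D unfolding is_gdrazin_inverse_def by (auto simp: fun_eq_iff)
  show left: "D (A x) = x" if "x \<in> range D" for x
    using that DAD by auto
  then show right: "A (D x) = x" if "x \<in> range D" for x
    using that comm by auto
  show "A x \<in> range D" if "x \<in> range D" for x
    using that comm by auto
  have "0 \<in> range D"
    using bounded_ops_zero[OF Dop] by (metis UNIV_I rangeI)
  moreover have "D x + D y \<in> range D" "c *\<^sub>C D x \<in> range D" for c x y
    using bounded_opsD[OF Dop] by (metis UNIV_I rangeI)+
  ultimately show "csubspace (range D)"
    unfolding complex_space.subspace_def by auto
  \<comment> \<open>A fixed-point set of a continuous map is closed.\<close>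
  have "range D = {x. D (A x) = x}"
    using left by (auto intro: range_eqI[OF sym])
  moreover have "bounded_linear (\<lambda>x. D (A x))"
    by (intro bounded_ops_bounded_linear[OF bounded_ops_compose[OF Dop A]])
  ultimately show "closed (range D)"
    by (simp add: closed_Collect_eq linear_continuous_on)
qed

lemma gdrazin_is_gdrazin_inverse: "gdrazin_invertible A \<Longrightarrow> is_gdrazin_inverse A (gdrazin A)"
  unfolding gdrazin_invertible_def gdrazin_def by (metis someI_ex)

text \<open>Since \<open>AD\<close> is the identity on \<open>R(D)\<close>, the operator
  \<open>DP\<close> meets both conditions. Any other solution \<open>C\<close> has range in
  \<open>R(D)\<close>, where \<open>DA\<close> is the identity, so
  \<open>C = DAC = DP\<close>.\<close>

lemma core_EP_eq:
  assumes "gdrazin_invertible A"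
  shows "core_EP A = gdrazin A \<circ> orth_proj (range (gdrazin A))"
proof -
  let ?D = "gdrazin A" and ?L = "range (gdrazin A)"
  have A: "A \<in> bounded_ops UNIV UNIV"
    using assms unfolding gdrazin_invertible_def by blast
  note D = gdrazin_is_gdrazin_inverse[OF assms]
  note L = gdrazin_inverse_range[OF A D]
  have Dop: "?D \<in> bounded_ops UNIV UNIV"
    using D unfolding is_gdrazin_inverse_def by blast
  show ?thesis
    unfolding core_EP_def
  proof (rule some_equality)
    have "?D \<circ> orth_proj ?L \<in> bounded_ops UNIV UNIV"
      unfolding comp_def
      by (intro bounded_ops_compose[OF Dop] bounded_ops_mono[OF orth_proj_bounded_ops[OF L(1,2)]]) auto
    then show "?D \<circ> orth_proj ?L \<in> bounded_ops UNIV UNIV \<and>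
        A \<circ> (?D \<circ> orth_proj ?L) = orth_proj ?L \<and> range (?D \<circ> orth_proj ?L) \<subseteq> ?L"
      using L(4)[OF orth_proj_in[OF L(1,2)]] by (auto simp: fun_eq_iff)
  next
    fix C assume C: "C \<in> bounded_ops UNIV UNIV \<and> A \<circ> C = orth_proj ?L \<and> range C \<subseteq> ?L"
    show "C = ?D \<circ> orth_proj ?L"
    proof
      fix x
      have "C x = ?D (A (C x))"
        using C by (intro L(3)[symmetric]) auto
      then show "C x = (?D \<circ> orth_proj ?L) x"
        using C by (auto simp: fun_eq_iff)
    qed
  qed
qed

lemma weak_group_inverse_eq:
  assumes "gdrazin_invertible A"
  shows "weak_group_inverse A x =
    gdrazin A (gdrazin A (orth_proj (range (gdrazin A)) (A x)))"
proof -
  have A: "A \<in> bounded_ops UNIV UNIV"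
    using assms unfolding gdrazin_invertible_def by blast
  note L = csubspace_range_gdrazin_inverse[OF A gdrazin_is_gdrazin_inverse[OF assms]]
  show ?thesis
    unfolding weak_group_inverse_def core_EP_eq[OF assms] by (simp add: orth_proj_id[OF L])
qed

text \<open>With respect to \<open>R(D)\<close> and \<open>M\<close>, the operator
  \<open>Q = A - A^2 D\<close> is block triangular: it vanishes on \<open>R(D)\<close>, and its
  lower right corner is that of \<open>A\<close>, because \<open>A^2 D\<close> maps into
  \<open>R(D)\<close>.\<close>

lemma quasinilpotent_on_compression:
  assumes A: "A \<in> bounded_ops UNIV UNIV" and D: "is_gdrazin_inverse A D"
    and M: "\<And>y. y \<in> M \<longleftrightarrow> (\<forall>x\<in>range D. cinner x y = 0)"
  shows "quasinilpotent_on M (\<lambda>y. A y - orth_proj (range D) (A y))"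
proof -
  define P where "P = orth_proj (range D)"
  define Q where "Q = (\<lambda>x. A x - A (A (D x)))"
  note L = gdrazin_inverse_range[OF A D]
  have sum: "orthogonal_sum (range D) M"
    by (intro orthogonal_sum_complement L M)
  then have Msub: "csubspace M"
    unfolding orthogonal_sum_def by blast
  have Pop: "P \<in> bounded_ops UNIV UNIV"
    unfolding P_def by (intro bounded_ops_mono[OF orth_proj_bounded_ops[OF L(1,2)]]) auto
  note Pd = bounded_ops_diff[OF Pop complex_space.subspace_UNIV UNIV_I UNIV_I]
  have PL: "P x \<in> range D" for x
    unfolding P_def by (intro orth_proj_in L)
  have Pid: "P x = x" if "x \<in> range D" for x
    unfolding P_def using that by (intro orth_proj_id L)
  have PM: "x - P x \<in> M" for x
    unfolding M P_def using orth_proj_orthogonal[OF L(1,2)] by (auto simp: cinner_eq_zero_commute)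
  have P0: "P y = 0" if "y \<in> M" for y
    unfolding P_def using that M complex_space.subspace_0[OF L(1)]
    by (intro orth_proj_eqI[OF L(1)]) (auto simp: cinner_eq_zero_commute)
  have comp: "(\<lambda>y. T y - P (T y)) \<in> bounded_ops M M" if "T \<in> bounded_ops UNIV UNIV" for T
    by (rule bounded_ops_mono[OF bounded_ops_minus[OF that bounded_ops_compose[OF Pop that]
        complex_space.subspace_UNIV]])
      (auto simp: PM)
  have AADL: "A (A (D x)) \<in> range D" for x
    by (intro L(5)) simp
  have "invertible_on M (\<lambda>y. (A y - P (A y)) - z *\<^sub>C y)" if z: "z \<noteq> 0" for z
  proof -
    have "z \<notin> spectrum_on UNIV Q"
      using D z unfolding is_gdrazin_inverse_def quasinilpotent_on_def Q_def by auto
    then have "invertible_on UNIV (\<lambda>x. Q x - z *\<^sub>C x)"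
      unfolding spectrum_on_def by simp
    then obtain S where Qz: "(\<lambda>x. Q x - z *\<^sub>C x) \<in> bounded_ops UNIV UNIV"
      and S: "S \<in> bounded_ops UNIV UNIV" and SQ: "\<And>x. S (Q x - z *\<^sub>C x) = x"
      and QS: "\<And>x. Q (S x) - z *\<^sub>C S x = x"
      unfolding invertible_on_def by auto
    note Sd = bounded_ops_diff[OF S complex_space.subspace_UNIV UNIV_I UNIV_I]
    \<comment> \<open>On \<open>range D\<close>, where \<open>Q\<close> is zero,
      \<open>Q - z\<close> is multiplication by \<open>-z\<close>; so its inverse \<open>S\<close>
      is multiplication by \<open>-1/z\<close> there.\<close>
    have SL: "S x \<in> range D" if x: "x \<in> range D" for x
    proof -
      let ?u = "(- inverse z) *\<^sub>C x"
      have u: "?u \<in> range D"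
        using x by (intro complex_space.subspace_scale L)
      then have "Q ?u = 0"
        by (simp add: Q_def L(4))
      then have "Q ?u - z *\<^sub>C ?u = x"
        using z by (simp add: scaleC_scaleC)
      then have "S x = ?u"
        using SQ[of ?u] by simp
      with u show ?thesis
        by simp
    qed
    \<comment> \<open>The complementary projector removes all terms in \<open>range D\<close>, so
      compressing \<open>Q - z\<close> at \<open>x\<close> only sees the component of
      \<open>x\<close> in \<open>M\<close>.\<close>
    have key: "(Q x - z *\<^sub>C x) - P (Q x - z *\<^sub>C x) =
        (A (x - P x) - P (A (x - P x))) - z *\<^sub>C (x - P x)" for x
    proof -
      have "Q x - z *\<^sub>C x = (Q (x - P x) - z *\<^sub>C (x - P x)) + (Q (P x) - z *\<^sub>C P x)"
        using bounded_ops_add[OF Qz UNIV_I UNIV_I, of "x - P x" "P x"] by simp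
      also have "\<dots> = (A (x - P x) - z *\<^sub>C (x - P x)) - (A (A (D (x - P x))) + z *\<^sub>C P x)"
        using L(4)[OF PL] by (simp add: Q_def)
      finally have eq: "Q x - z *\<^sub>C x =
          (A (x - P x) - z *\<^sub>C (x - P x)) - (A (A (D (x - P x))) + z *\<^sub>C P x)" .
      have "A (A (D (x - P x))) + z *\<^sub>C P x \<in> range D"
        by (intro complex_space.subspace_add complex_space.subspace_scale L(1) AADL PL)
      moreover have "P (z *\<^sub>C (x - P x)) = 0"
        by (intro P0 complex_space.subspace_scale Msub PM)
      ultimately show ?thesis
        unfolding eq by (simp add: Pd Pid)
    qed
    have "(\<lambda>y. (A y - P (A y)) - z *\<^sub>C y) \<in> bounded_ops M M"
      by (intro bounded_ops_minus comp A bounded_ops_mult_left Msub)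
    moreover have "(\<lambda>y. S y - P (S y)) \<in> bounded_ops M M"
      by (rule comp[OF S])
    moreover have "S (A y - P (A y) - z *\<^sub>C y) - P (S (A y - P (A y) - z *\<^sub>C y)) = y"
      if y: "y \<in> M" for y
    proof -
      let ?v = "Q y - z *\<^sub>C y"
      have eq: "A y - P (A y) - z *\<^sub>C y = ?v - P ?v"
        using key[of y] P0[OF y] by simp
      \<comment> \<open>The error term \<open>S (P ?v)\<close> stays in \<open>range D\<close> by
        \<open>SL\<close>, so it disappears under compression.\<close>
      have Seq: "S (A y - P (A y) - z *\<^sub>C y) = y - S (P ?v)"
        by (simp only: eq Sd[of ?v "P ?v"] SQ)
      then show ?thesis
        by (simp only: Seq Pd[of y "S (P ?v)"] P0[OF y] Pid[OF SL[OF PL]]) simp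
    qed
    \<comment> \<open>This is \<open>key\<close> at \<open>S y\<close>.\<close>
    moreover have "A (S y - P (S y)) - P (A (S y - P (S y))) - z *\<^sub>C (S y - P (S y)) = y"
      if y: "y \<in> M" for y
      by (simp only: key[symmetric] QS P0[OF y]) simp
    ultimately show ?thesis
      unfolding invertible_on_def
      by (intro conjI bexI[of _ "\<lambda>y. S y - P (S y)"] ballI)
  qed
  then have "spectrum_on M (\<lambda>y. A y - P (A y)) \<subseteq> {0}"
    unfolding spectrum_on_def by auto
  with comp[OF A] show ?thesis
    unfolding quasinilpotent_on_def P_def by (rule conjI)
qed


section \<open>The weak group relation\<close>

text \<open>Block entries are total functions that matter only on \<open>L\<close> or
  \<open>M\<close>; accordingly \<open>inv_into L A1\<close> plays the role of the inverse of
  \<open>A1\<close> on \<open>L\<close>.\<close>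

theorem corollary3p2:
  fixes A B :: "'a::complex_hilbert \<Rightarrow> 'a"
  assumes "infinite_dimensional TYPE('a)"
    and "A \<in> bounded_ops UNIV UNIV" and "gdrazin_invertible A"
    and "B \<in> bounded_ops UNIV UNIV"
  defines "L \<equiv> range (gdrazin A)"
    and "M \<equiv> null_space (adj (gdrazin A))"
  shows "A \<le>\<^sub>w\<^sub>g B \<longleftrightarrow>
    (\<exists>A1 A2 A3 B3.
       block_rep L M A A1 A2 (\<lambda>x. 0) A3 \<and>
       block_rep L M B A1 (\<lambda>y. A2 y + inv_into L A1 (A2 (A3 y - B3 y))) (\<lambda>x. 0) B3 \<and>
       invertible_on L A1 \<and> quasinilpotent_on M A3)"
proof -
  define D where "D = gdrazin A"
  define P where "P = orth_proj L"
  define W where "W = weak_group_inverse A"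
  have A: "A \<in> bounded_ops UNIV UNIV" and B: "B \<in> bounded_ops UNIV UNIV"
    by fact+
  have gD: "is_gdrazin_inverse A D"
    unfolding D_def by (rule gdrazin_is_gdrazin_inverse) fact
  then have Dop: "D \<in> bounded_ops UNIV UNIV"
    unfolding is_gdrazin_inverse_def by blast
  have LD: "L = range D"
    by (simp add: L_def D_def)
  note L = gdrazin_inverse_range[OF A gD, folded LD]
  have M: "y \<in> M \<longleftrightarrow> (\<forall>x\<in>L. cinner x y = 0)" for y
    unfolding M_def LD D_def[symmetric] by (rule mem_null_space_adj_iff[OF Dop])
  have sum: "orthogonal_sum L M"
    by (intro orthogonal_sum_complement L M)
  then have Msub: "csubspace M"
    unfolding orthogonal_sum_def by blast
  note zero_in = complex_space.subspace_0[OF L(1)] complex_space.subspace_0[OF Msub]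
  have PopL: "P \<in> bounded_ops UNIV L"
    unfolding P_def by (intro orth_proj_bounded_ops L)
  then have Pop: "P \<in> bounded_ops UNIV UNIV"
    by (rule bounded_ops_mono) auto
  note diff = bounded_ops_diff[OF _ complex_space.subspace_UNIV UNIV_I UNIV_I]
  note add = bounded_ops_add[OF _ UNIV_I UNIV_I]
  have PL: "P x \<in> L" for x
    unfolding P_def by (intro orth_proj_in L)
  have Pid: "P x = x" if "x \<in> L" for x
    unfolding P_def using that by (intro orth_proj_id L)
  have PM: "x - P x \<in> M" for x
    unfolding M P_def using orth_proj_orthogonal[OF L(1,2)] by (auto simp: cinner_eq_zero_commute)
  have P0: "P y = 0" if "y \<in> M" for y
    unfolding P_def using that M zero_in
    by (intro orth_proj_eqI[OF L(1)]) (auto simp: cinner_eq_zero_commute)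
  have DL: "D x \<in> L" for x
    by (simp add: LD)
  have W: "W x = D (D (P (A x)))" for x
    unfolding W_def D_def P_def L_def by (rule weak_group_inverse_eq) fact
  have WL: "W x \<in> L" for x
    by (simp add: W DL)
  have Wdiff: "W (x - y) = W x - W y" for x y
    by (simp add: W diff[OF A] diff[OF Pop] diff[OF Dop])
  have wg: "A \<le>\<^sub>w\<^sub>g B \<longleftrightarrow> (\<forall>x. A (W x) = B (W x)) \<and> (\<forall>x. W (A x) = W (B x))"
    unfolding weak_group_le_def W_def[symmetric] by (simp add: fun_eq_iff)
  show ?thesis
  proof
    assume "A \<le>\<^sub>w\<^sub>g B"
    then have AW: "\<And>x. A (W x) = B (W x)" and WA: "\<And>x. W (A x) = W (B x)"
      unfolding wg by auto
    \<comment> \<open>The corners are compressions of \<open>A\<close> and \<open>B\<close>; for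
      \<open>A1\<close> the operator \<open>A\<close> itself is taken, since it maps
      \<open>L\<close> into \<open>L\<close>.\<close>
    define A2 where "A2 = (\<lambda>y. P (A y))"
    define A3 where "A3 = (\<lambda>y. A y - P (A y))"
    define B3 where "B3 = (\<lambda>y. B y - P (B y))"
    \<comment> \<open>Each \<open>x\<close> in \<open>L\<close> is a value of \<open>W\<close>,
      namely at \<open>A x\<close>, so \<open>AW = BW\<close> applies to it.\<close>
    have AB: "B x = A x" if x: "x \<in> L" for x
    proof -
      have "W (A x) = x"
        by (simp add: W Pid L x)
      then show ?thesis
        using AW[of "A x"] by simp
    qed
    have inv: "inv_into L A u = D u" if "u \<in> L" for u
    proof (rule inv_into_f_eq)
      show "inj_on A L"
        by (rule inj_on_inverseI[of _ D]) (rule L(3))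
    qed (use that L(4) DL in auto)
    have B2: "P (B y) = A2 y + D (A2 (A3 y - B3 y))" if y: "y \<in> M" for y
    proof -
      let ?u = "A3 y - B3 y" and ?l = "P (A y) - P (B y)"
      have l: "?l \<in> L"
        by (intro complex_space.subspace_diff L(1) PL)
      have "W (A y - B y) = 0"
        by (simp add: Wdiff WA)
      \<comment> \<open>Applying \<open>A\<close> twice strips the two factors \<open>D\<close>, as
        \<open>AD\<close> is the identity on \<open>L\<close>.\<close>
      then have "A (A (D (D (P (A (A y - B y)))))) = 0"
        by (simp add: W bounded_ops_zero[OF A])
      then have "P (A (A y - B y)) = 0"
        by (simp add: L(4) PL DL)
      \<comment> \<open>Splitting into components in \<open>L\<close> and \<open>M\<close> turns the
        last equation into \<open>A ?l + A2 ?u = 0\<close>; applying \<open>D\<close> then solves it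
        for \<open>P (B y)\<close>.\<close>
      moreover have "A y - B y = ?l + ?u"
        by (simp add: A3_def B3_def)
      ultimately have "A ?l + A2 ?u = 0"
        by (simp add: add[OF A] add[OF Pop] Pid L(5) l A2_def)
      then have "D (A ?l) + D (A2 ?u) = 0"
        using bounded_ops_zero[OF Dop] by (simp add: add[OF Dop, symmetric])
      then show ?thesis
        by (simp add: L(3) l A2_def algebra_simps)
    qed
    have A1op: "A \<in> bounded_ops L L"
      by (rule bounded_ops_mono[OF A]) (auto intro: L)
    have A2op: "A2 \<in> bounded_ops M L"
      unfolding A2_def by (rule bounded_ops_mono[OF bounded_ops_compose[OF PopL A]]) (auto simp: PL)
    have comp: "(\<lambda>y. T y - P (T y)) \<in> bounded_ops M M" if "T \<in> bounded_ops UNIV UNIV" for T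
      by (rule bounded_ops_mono[OF bounded_ops_minus[OF that bounded_ops_compose[OF Pop that]
          complex_space.subspace_UNIV]])
        (auto simp: PM)
    have A3op: "A3 \<in> bounded_ops M M" and B3op: "B3 \<in> bounded_ops M M"
      unfolding A3_def B3_def by (intro comp A B)+
    have inv2: "inv_into L A (A2 (A3 y - B3 y)) = D (A2 (A3 y - B3 y))" for y
      by (intro inv) (simp add: A2_def PL)
    have PB: "(\<lambda>y. P (B y)) \<in> bounded_ops M L"
      by (rule bounded_ops_mono[OF bounded_ops_compose[OF PopL B]]) (auto simp: PL)
    \<comment> \<open>On \<open>M\<close> this corner coincides with \<open>PB\<close>, from which
      it inherits linearity and the bound.\<close>
    have B2op: "(\<lambda>y. A2 y + inv_into L A (A2 (A3 y - B3 y))) \<in> bounded_ops M L"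
      unfolding inv2 using PB Msub B2
      by (simp add: bounded_ops_def image_subset_iff complex_space.subspace_add complex_space.subspace_scale)
    have "block_rep L M A A A2 (\<lambda>x. 0) A3"
      unfolding block_rep_def using sum A1op A2op A3op bounded_ops_const_zero[OF zero_in(2)]
      by (auto simp: add[OF A] A2_def A3_def)
    moreover have B_M: "B y = (A2 y + inv_into L A (A2 (A3 y - B3 y))) + B3 y" if "y \<in> M" for y
      unfolding inv2 B2[OF that, symmetric] by (simp add: B3_def)
    moreover have "block_rep L M B A (\<lambda>y. A2 y + inv_into L A (A2 (A3 y - B3 y))) (\<lambda>x. 0) B3"
      unfolding block_rep_def using sum A1op B2op B3op bounded_ops_const_zero[OF zero_in(2)]
      by (auto simp: add[OF B] AB B_M)
    moreover have "invertible_on L A"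
      unfolding invertible_on_def using A1op L(3,4) DL bounded_ops_mono[OF Dop, of L L]
      by blast
    moreover have "quasinilpotent_on M A3"
      unfolding A3_def P_def LD by (intro quasinilpotent_on_compression A gD) (simp add: M LD)
    ultimately show "\<exists>A1 A2 A3 B3.
       block_rep L M A A1 A2 (\<lambda>x. 0) A3 \<and>
       block_rep L M B A1 (\<lambda>y. A2 y + inv_into L A1 (A2 (A3 y - B3 y))) (\<lambda>x. 0) B3 \<and>
       invertible_on L A1 \<and> quasinilpotent_on M A3"
      by blast
  next
    assume "\<exists>A1 A2 A3 B3.
       block_rep L M A A1 A2 (\<lambda>x. 0) A3 \<and>
       block_rep L M B A1 (\<lambda>y. A2 y + inv_into L A1 (A2 (A3 y - B3 y))) (\<lambda>x. 0) B3 \<and>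
       invertible_on L A1 \<and> quasinilpotent_on M A3"
    then obtain A1 A2 A3 B3 where rA: "block_rep L M A A1 A2 (\<lambda>x. 0) A3"
      and rB: "block_rep L M B A1 (\<lambda>y. A2 y + inv_into L A1 (A2 (A3 y - B3 y))) (\<lambda>x. 0) B3"
      and A1: "invertible_on L A1"
      by blast
    let ?B2 = "\<lambda>y. A2 y + inv_into L A1 (A2 (A3 y - B3 y))"
    have ops: "A1 \<in> bounded_ops L L" "A2 \<in> bounded_ops M L" "A3 \<in> bounded_ops M M"
        "?B2 \<in> bounded_ops M L" "B3 \<in> bounded_ops M M"
      and A_eq: "\<And>x y. x \<in> L \<Longrightarrow> y \<in> M \<Longrightarrow> A (x + y) = A1 x + A2 y + A3 y"
      and B_eq: "\<And>x y. x \<in> L \<Longrightarrow> y \<in> M \<Longrightarrow> B (x + y) = A1 x + ?B2 y + B3 y"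
      using rA rB unfolding block_rep_def by auto
    have A_L: "A x = A1 x" if "x \<in> L" for x
      using A_eq[OF that zero_in(2)] ops zero_in by (simp add: bounded_ops_zero)
    have B_L: "B x = A1 x" if "x \<in> L" for x
      using B_eq[OF that zero_in(2)] bounded_ops_zero[OF ops(4)] bounded_ops_zero[OF ops(5)] zero_in
      by simp
    have A_M: "A y = A2 y + A3 y" if "y \<in> M" for y
      using A_eq[OF zero_in(1) that] bounded_ops_zero[OF ops(1)] zero_in by simp
    have "W (A z) = W (B z)" for z
    proof -
      obtain x y where z: "x \<in> L" "y \<in> M" "z = x + y"
        using sum unfolding orthogonal_sum_def by blast
      let ?u = "A3 y - B3 y"
      let ?v = "inv_into L A1 (A2 ?u)"
      have u: "?u \<in> M"
        using z(2) by (intro complex_space.subspace_diff[OF Msub] bounded_ops_in[OF ops(3)]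
            bounded_ops_in[OF ops(5)])
      have A2u: "A2 ?u \<in> L"
        by (rule bounded_ops_in[OF ops(2) u])
      obtain S where "S \<in> bounded_ops L L" "\<forall>x\<in>L. S (A1 x) = x \<and> A1 (S x) = x"
        using A1 unfolding invertible_on_def by blast
      \<comment> \<open>Surjectivity of \<open>A1\<close> on \<open>L\<close> ensures that
        \<open>inv_into\<close> returns a genuine preimage of \<open>A2 ?u\<close>.\<close>
      then have "A2 ?u \<in> A1 ` L"
        using A2u bounded_ops_in[of S L L] by (metis image_eqI)
      then have v: "?v \<in> L" "A1 ?v = A2 ?u"
        by (rule inv_into_into, rule f_inv_into_f)
      have "A z - B z = ?u - ?v"
        using A_eq[OF z(1,2)] B_eq[OF z(1,2)] z(3) by simp
      \<comment> \<open>The contribution \<open>A2 ?u\<close> of \<open>?u\<close> to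
        \<open>L\<close> cancels against \<open>A1 ?v\<close>. What remains lies in
        \<open>M\<close>, where \<open>P\<close> and therefore \<open>D^2 P\<close> give
        zero.\<close>
      then have "A (A z - B z) = A3 ?u"
        using A_M[OF u] A_L[OF v(1)] v(2) by (simp add: diff[OF A])
      then have "W (A z - B z) = 0"
        using P0[OF bounded_ops_in[OF ops(3) u]] bounded_ops_zero[OF Dop] by (simp add: W)
      then show ?thesis
        by (simp add: Wdiff)
    qed
    then show "A \<le>\<^sub>w\<^sub>g B"
      \<comment> \<open>The equation \<open>AW = BW\<close> holds because \<open>W\<close> maps into
        \<open>L\<close>, where both operators equal \<open>A1\<close>.\<close>
      unfolding wg using A_L[OF WL] B_L[OF WL] by simp
  qed
qed

end
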